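(* Let $\mathcal{G}$ be an ample compactly generated groupoid. Let $U$ be a full clopen subset of $\mathcal{G}^{(0)}$, i.e. $U$ meets every $\mathcal{G}$-orbit. Then $\mathcal{G}|_U^U$ is compactly generated.
   Context: A topological groupoid $\mathcal{G}$ with range and source maps $r,s$ and unit space $\mathcal{G}^{(0)}$ is étale if $r,s$ are local homeomorphisms, and ample if it is étale and its unit space is (locally compact Hausdorff and) totally disconnected. $\mathcal{G}$ is compactly generated if there is a compact $K\subset\mathcal{G}$ with $\mathcal{G}=\bigcup_{n\in\mathbb{N}}(K\cup K^{-1})^n$, where $B_1B_2=\{\gamma_1\gamma_2:\gamma_i\in B_i,\ \gamma_1\gamma_2\text{ defined}\}$. The orbit of a unit $u$ is $\{r(\gamma): s(\gamma)=u\}$. $\mathcal{G}|_U^U=\{\gamma\in\mathcal{G}: s(\gamma),r(\gamma)\in U\}$ with the subspace topology. *)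

theory Defs
  imports "HOL-Analysis.Analysis"
begin

text \<open>
  A groupoid is encoded by its arrows, the points of the topology \<open>arr_top G\<close>; units are
  identified with identity arrows. \<open>gmult G g h\<close> is only meaningful when \<open>src G g = rng G h\<close>.
  The topology on the arrows is not assumed to be Hausdorff, and compactness is the
  finite-subcover property \<^const>\<open>compactin\<close>.
\<close>

record 'a groupoid_data =
  arr_top :: "'a topology"
  rng :: "'a \<Rightarrow> 'a"
  src :: "'a \<Rightarrow> 'a"
  gmult :: "'a \<Rightarrow> 'a \<Rightarrow> 'a"
  ginv :: "'a \<Rightarrow> 'a"

abbreviation arrows :: "'a groupoid_data \<Rightarrow> 'a set" where
  "arrows G \<equiv> topspace (arr_top G)"

definition units :: "'a groupoid_data \<Rightarrow> 'a set" where
  "units G = rng G ` arrows G"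

definition unit_top :: "'a groupoid_data \<Rightarrow> 'a topology" where
  "unit_top G = subtopology (arr_top G) (units G)"

definition composable :: "'a groupoid_data \<Rightarrow> ('a \<times> 'a) set" where
  "composable G = {(g, h). g \<in> arrows G \<and> h \<in> arrows G \<and> src G g = rng G h}"

locale groupoid =
  fixes G :: "'a groupoid_data"
  assumes rng_in: "g \<in> arrows G \<Longrightarrow> rng G g \<in> arrows G"
    and src_in: "g \<in> arrows G \<Longrightarrow> src G g \<in> arrows G"
    and rng_rng: "g \<in> arrows G \<Longrightarrow> rng G (rng G g) = rng G g"
    and src_rng: "g \<in> arrows G \<Longrightarrow> src G (rng G g) = rng G g"
    and rng_src: "g \<in> arrows G \<Longrightarrow> rng G (src G g) = src G g"
    and src_src: "g \<in> arrows G \<Longrightarrow> src G (src G g) = src G g"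
    and mult_in: "(g, h) \<in> composable G \<Longrightarrow> gmult G g h \<in> arrows G"
    and rng_mult: "(g, h) \<in> composable G \<Longrightarrow> rng G (gmult G g h) = rng G g"
    and src_mult: "(g, h) \<in> composable G \<Longrightarrow> src G (gmult G g h) = src G h"
    and mult_assoc: "(g, h) \<in> composable G \<Longrightarrow> (h, k) \<in> composable G \<Longrightarrow>
      gmult G (gmult G g h) k = gmult G g (gmult G h k)"
    and rng_left: "g \<in> arrows G \<Longrightarrow> gmult G (rng G g) g = g"
    and src_right: "g \<in> arrows G \<Longrightarrow> gmult G g (src G g) = g"
    and inv_in: "g \<in> arrows G \<Longrightarrow> ginv G g \<in> arrows G"
    and rng_inv: "g \<in> arrows G \<Longrightarrow> rng G (ginv G g) = src G g"
    and src_inv: "g \<in> arrows G \<Longrightarrow> src G (ginv G g) = rng G g"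
    and mult_inv: "g \<in> arrows G \<Longrightarrow> gmult G g (ginv G g) = rng G g"
    and inv_mult: "g \<in> arrows G \<Longrightarrow> gmult G (ginv G g) g = src G g"

text \<open>Continuity of \<open>rng\<close> and \<open>src\<close> follows, as \<open>rng G g\<close> is \<open>g\<close> times its inverse.\<close>

locale topological_groupoid = groupoid +
  assumes continuous_mult:
      "continuous_map
         (subtopology (prod_topology (arr_top G) (arr_top G)) (composable G))
         (arr_top G) (\<lambda>(g, h). gmult G g h)"
    and continuous_inv: "continuous_map (arr_top G) (arr_top G) (ginv G)"

definition local_homeomorphism ::
  "'a topology \<Rightarrow> 'b topology \<Rightarrow> ('a \<Rightarrow> 'b) \<Rightarrow> bool" where
  "local_homeomorphism X Y f \<longleftrightarrow>
     (\<forall>x \<in> topspace X. \<exists>W. openin X W \<and> x \<in> W \<and> openin Y (f ` W) \<and>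
        homeomorphic_map (subtopology X W) (subtopology Y (f ` W)) f)"

definition totally_disconnected :: "'a topology \<Rightarrow> bool" where
  "totally_disconnected X \<longleftrightarrow> (\<forall>S. connectedin X S \<longrightarrow> (\<exists>x. S \<subseteq> {x}))"

locale etale_groupoid = topological_groupoid +
  assumes local_homeomorphism_rng: "local_homeomorphism (arr_top G) (unit_top G) (rng G)"
    and local_homeomorphism_src: "local_homeomorphism (arr_top G) (unit_top G) (src G)"

locale ample_groupoid = etale_groupoid +
  assumes locally_compact_units: "locally_compact_space (unit_top G)"
    and Hausdorff_units: "Hausdorff_space (unit_top G)"
    and totally_disconnected_units: "totally_disconnected (unit_top G)"

definition setmult :: "'a groupoid_data \<Rightarrow> 'a set \<Rightarrow> 'a set \<Rightarrow> 'a set" where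
  "setmult G B C = {gmult G g h | g h. g \<in> B \<and> h \<in> C \<and> (g, h) \<in> composable G}"

text \<open>The unit space is the neutral element for \<^const>\<open>setmult\<close>, hence the zeroth power.\<close>

primrec setpow :: "'a groupoid_data \<Rightarrow> 'a set \<Rightarrow> nat \<Rightarrow> 'a set" where
  "setpow G B 0 = units G"
| "setpow G B (Suc n) = setmult G (setpow G B n) B"

definition compactly_generated :: "'a groupoid_data \<Rightarrow> bool" where
  "compactly_generated G \<longleftrightarrow>
     (\<exists>K. compactin (arr_top G) K \<and> arrows G = (\<Union>n. setpow G (K \<union> ginv G ` K) n))"

definition orbit :: "'a groupoid_data \<Rightarrow> 'a \<Rightarrow> 'a set" where
  "orbit G u = {rng G g | g. g \<in> arrows G \<and> src G g = u}"

definition full :: "'a groupoid_data \<Rightarrow> 'a set \<Rightarrow> bool" where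
  "full G U \<longleftrightarrow> (\<forall>u \<in> units G. orbit G u \<inter> U \<noteq> {})"

definition reduction :: "'a groupoid_data \<Rightarrow> 'a set \<Rightarrow> 'a groupoid_data" where
  "reduction G U =
     G\<lparr>arr_top := subtopology (arr_top G) {g \<in> arrows G. src G g \<in> U \<and> rng G g \<in> U}\<rparr>"

lemma arrows_reduction:
  "arrows (reduction G U) = {g \<in> arrows G. src G g \<in> U \<and> rng G g \<in> U}"
  by (auto simp: reduction_def)

lemma reduction_sel [simp]:
  "rng (reduction G U) = rng G" "src (reduction G U) = src G"
  "gmult (reduction G U) = gmult G" "ginv (reduction G U) = ginv G"
  by (simp_all add: reduction_def)

lemma (in groupoid) unit_iff: "u \<in> units G \<longleftrightarrow> u \<in> arrows G \<and> rng G u = u"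
  by (force simp: units_def rng_in rng_rng)

lemma (in groupoid) units_reduction:
  assumes "U \<subseteq> units G"
  shows "units (reduction G U) = U"
proof
  show "units (reduction G U) \<subseteq> U"
    by (auto simp: units_def arrows_reduction)
  show "U \<subseteq> units (reduction G U)"
  proof
    fix u assume "u \<in> U"
    then have u: "u \<in> arrows G" "rng G u = u" using assms unit_iff by auto
    then have "src G u = u" using src_rng by metis
    with u \<open>u \<in> U\<close> have "u \<in> arrows (reduction G U)" by (simp add: arrows_reduction)
    with u show "u \<in> units (reduction G U)" by (force simp: units_def)
  qed
qed

lemma (in groupoid) groupoid_reduction:
  assumes "U \<subseteq> units G"
  shows "groupoid (reduction G U)"
proof -
  have comp: "(g, h) \<in> composable G" if "(g, h) \<in> composable (reduction G U)" for g h
    using that by (auto simp: composable_def arrows_reduction)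
  show ?thesis
    by unfold_locales
      (auto simp: arrows_reduction rng_in src_in rng_rng src_rng rng_src src_src rng_left
        src_right inv_in rng_inv src_inv mult_inv inv_mult mult_in[OF comp] rng_mult[OF comp]
        src_mult[OF comp] mult_assoc[OF comp comp], auto simp: composable_def arrows_reduction)
qed

lemma (in topological_groupoid) topological_groupoid_reduction:
  assumes "U \<subseteq> units G"
  shows "topological_groupoid (reduction G U)"
proof -
  interpret R: groupoid "reduction G U" using assms by (rule groupoid_reduction)
  define A where "A = {g \<in> arrows G. src G g \<in> U \<and> rng G g \<in> U}"
  have T: "arr_top (reduction G U) = subtopology (arr_top G) A"
    by (simp add: reduction_def A_def)
  have sub: "composable (reduction G U) = (A \<times> A) \<inter> composable G"
    by (auto simp: composable_def arrows_reduction A_def)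
  have mult: "(\<lambda>(g, h). gmult G g h) ` ((A \<times> A) \<inter> composable G) \<subseteq> A"
    using R.mult_in unfolding sub arrows_reduction A_def[symmetric] by auto
  have inv: "ginv G ` A \<subseteq> A"
    using R.inv_in unfolding arrows_reduction A_def[symmetric] by auto
  have top: "subtopology (prod_topology (subtopology (arr_top G) A) (subtopology (arr_top G) A))
      (A \<times> A \<inter> composable G) =
    subtopology (subtopology (prod_topology (arr_top G) (arr_top G)) (composable G)) (A \<times> A)"
    by (simp add: subtopology_Times[symmetric] subtopology_subtopology Int_ac)
  have m: "continuous_map
      (subtopology (prod_topology (subtopology (arr_top G) A) (subtopology (arr_top G) A))
        (A \<times> A \<inter> composable G)) (subtopology (arr_top G) A) (\<lambda>(g, h). gmult G g h)"
    using mult unfolding top continuous_map_in_subtopology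
    by (auto intro!: continuous_map_from_subtopology continuous_mult)
  have i: "continuous_map (subtopology (arr_top G) A) (subtopology (arr_top G) A) (ginv G)"
    using inv unfolding continuous_map_in_subtopology
    by (auto intro!: continuous_map_from_subtopology continuous_inv)
  show ?thesis
    by unfold_locales (simp_all add: T sub m i)
qed

end

theory Submission
  imports Defs
begin

text \<open>
  Let \<open>K\<close> generate \<open>G\<close>, put \<open>S = K \<union> K\<inverse>\<close> and let \<open>C\<close> be the compact set of sources of elements
  of \<open>S\<close>. Since \<open>U\<close> is full and open, and \<open>src\<close> is a local homeomorphism onto a locally compact
  Hausdorff space, there is a compact set \<open>L\<close> of arrows with \<open>C \<subseteq> src L\<close> and \<open>rng L \<subseteq> U\<close>; as
  \<open>U\<close> is closed, \<open>C \<inter> U\<close> can be included in \<open>L\<close>. Then \<open>L S L\<inverse>\<close> is compact and generates the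
  reduction: a product \<open>s\<^sub>1 \<dots> s\<^sub>n\<close> with both ends in \<open>U\<close> can be rewritten by inserting
  \<open>l\<^sub>i\<inverse> l\<^sub>i\<close>, with \<open>l\<^sub>i\<close> in \<open>L\<close>, between consecutive factors. The unit space need not be compact:
  the units outside \<open>C\<close> are reached only by the zeroth power.
\<close>

section \<open>Local homeomorphisms and lifting of compact sets\<close>

lemma local_homeomorphism_imp_continuous_map:
  assumes "local_homeomorphism X Y f"
  shows "continuous_map X Y f"
  unfolding continuous_map_openin_preimage_eq
proof (intro conjI ballI allI impI)
  show "f \<in> topspace X \<rightarrow> topspace Y"
  proof
    fix x assume "x \<in> topspace X"
    then obtain W where "x \<in> W" "openin Y (f ` W)"
      using assms unfolding local_homeomorphism_def by blast
    then show "f x \<in> topspace Y" using openin_subset by blast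
  qed
next
  fix V assume V: "openin Y V"
  show "openin X (topspace X \<inter> f -` V)"
  proof (subst openin_subopen, intro ballI)
    fix x assume x: "x \<in> topspace X \<inter> f -` V"
    then obtain W where W: "openin X W" "x \<in> W"
      "homeomorphic_map (subtopology X W) (subtopology Y (f ` W)) f"
      using assms unfolding local_homeomorphism_def by blast
    then have "continuous_map (subtopology X W) Y f"
      using homeomorphic_imp_continuous_map continuous_map_into_fulltopology by blast
    then have "openin (subtopology X W) {y \<in> topspace (subtopology X W). f y \<in> V}"
      using V by (rule openin_continuous_map_preimage)
    then have "openin X {y \<in> topspace (subtopology X W). f y \<in> V}"
      using W(1) openin_trans_full by blast
    then show "\<exists>T. openin X T \<and> x \<in> T \<and> T \<subseteq> topspace X \<inter> f -` V"
      using x W by (intro exI[of _ "{y \<in> topspace (subtopology X W). f y \<in> V}"]) auto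
  qed
qed

lemma local_homeomorphism_compact_neighbourhood:
  assumes f: "local_homeomorphism X Y f"
    and Y: "neighbourhood_base_of (compactin Y) Y"
    and N: "openin X N" "x \<in> N"
  obtains V L where "openin Y V" "f x \<in> V" "V \<subseteq> f ` L" "compactin X L" "L \<subseteq> N"
proof -
  have "x \<in> topspace X" using N openin_subset by blast
  then obtain W where W: "openin X W" "x \<in> W" "openin Y (f ` W)"
      "homeomorphic_map (subtopology X W) (subtopology Y (f ` W)) f"
    using f unfolding local_homeomorphism_def by blast
  have "openin (subtopology X W) (W \<inter> N)"
    using N(1) by (simp add: openin_subtopology_Int2)
  then have "openin (subtopology Y (f ` W)) (f ` (W \<inter> N))"
    using homeomorphic_imp_open_map[OF W(4)] unfolding open_map_def by blast
  then have "openin Y (f ` (W \<inter> N))"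
    using W(3) openin_trans_full by blast
  moreover have "f x \<in> f ` (W \<inter> N)" using N W by blast
  ultimately obtain V D where VD: "openin Y V" "compactin Y D" "f x \<in> V" "V \<subseteq> D"
      "D \<subseteq> f ` (W \<inter> N)"
    using Y unfolding neighbourhood_base_of by metis
  define L where "L = {y \<in> W \<inter> N. f y \<in> D}"
  have fL: "f ` L = D" using VD(5) by (auto simp: L_def)
  have "compactin (subtopology Y (f ` W)) (f ` L)"
    using VD by (auto simp: fL compactin_subtopology)
  moreover have "L \<subseteq> topspace (subtopology X W)"
    using W(1) openin_subset by (fastforce simp: L_def)
  ultimately have "compactin (subtopology X W) L"
    using homeomorphic_map_compactness[OF W(4)] by blast
  then have "compactin X L" by (simp add: compactin_subtopology)
  then show thesis
    using that[of V L] VD fL by (auto simp: L_def)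
qed

text \<open>Finitely many of the open sets \<open>V\<close> from the local version cover
  \<open>C\<close>, and the union of their compact lifts is again compact.\<close>

lemma local_homeomorphism_lift_compact:
  assumes f: "local_homeomorphism X Y f"
    and Y: "neighbourhood_base_of (compactin Y) Y"
    and N: "openin X N" and C: "compactin Y C" "C \<subseteq> f ` N"
  obtains L where "compactin X L" "L \<subseteq> N" "C \<subseteq> f ` L"
proof -
  define P where "P V L \<longleftrightarrow> V \<subseteq> f ` L \<and> compactin X L \<and> L \<subseteq> N" for V L
  define \<V> where "\<V> = {V. openin Y V \<and> (\<exists>L. P V L)}"
  have "C \<subseteq> \<Union>\<V>"
  proof
    fix u assume "u \<in> C"
    then obtain x where x: "x \<in> N" "u = f x" using C by blast
    obtain V L where "openin Y V" "f x \<in> V" "V \<subseteq> f ` L" "compactin X L" "L \<subseteq> N"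
      using local_homeomorphism_compact_neighbourhood[OF f Y N x(1)] .
    then show "u \<in> \<Union>\<V>" unfolding \<V>_def P_def x(2) by blast
  qed
  then obtain \<F> where F: "finite \<F>" "\<F> \<subseteq> \<V>" "C \<subseteq> \<Union>\<F>"
    using C(1) unfolding compactin_def \<V>_def by (metis (no_types, lifting) mem_Collect_eq)
  then have "\<forall>V\<in>\<F>. \<exists>L. P V L" by (auto simp: \<V>_def)
  then obtain l where l: "\<And>V. V \<in> \<F> \<Longrightarrow> P V (l V)" by metis
  show thesis
  proof
    show "compactin X (\<Union>(l ` \<F>))"
      using F(1) l by (intro compactin_Union) (auto simp: P_def)
    show "\<Union>(l ` \<F>) \<subseteq> N" using l by (auto simp: P_def)
    show "C \<subseteq> f ` \<Union>(l ` \<F>)"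
    proof
      fix u assume "u \<in> C"
      then obtain V where "V \<in> \<F>" "u \<in> V" using F(3) by blast
      then show "u \<in> f ` \<Union>(l ` \<F>)" using l[of V] unfolding P_def by blast
    qed
  qed
qed

section \<open>Powers of sets of arrows and groupoid identities\<close>

lemma setmultI:
  "g \<in> B \<Longrightarrow> h \<in> C \<Longrightarrow> (g, h) \<in> composable G \<Longrightarrow> gmult G g h \<in> setmult G B C"
  by (auto simp: setmult_def)

lemma setmult_mono: "B \<subseteq> B' \<Longrightarrow> C \<subseteq> C' \<Longrightarrow> setmult G B C \<subseteq> setmult G B' C'"
  unfolding setmult_def by blast

lemma setpow_mono: "B \<subseteq> C \<Longrightarrow> setpow G B n \<subseteq> setpow G C n"
  by (induction n) (simp_all add: setmult_mono)

context groupoid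
begin

text \<open>Serves to show that a set of the form K together with its inverses is closed under
  inversion.\<close>

lemma inv_inv:
  assumes "g \<in> arrows G"
  shows "ginv G (ginv G g) = g"
proof -
  let ?h = "ginv G g" and ?k = "ginv G (ginv G g)"
  have a: "?h \<in> arrows G" "?k \<in> arrows G" using assms inv_in by auto
  have "?k = gmult G (gmult G g ?h) ?k"
    using assms a rng_left[of ?k] by (simp add: rng_inv src_inv mult_inv)
  also have "\<dots> = gmult G g (gmult G ?h ?k)"
    using assms a by (intro mult_assoc) (auto simp: composable_def rng_inv src_inv)
  also have "\<dots> = g"
    using assms a by (simp add: mult_inv rng_inv src_right)
  finally show ?thesis .
qed

lemma units_subset_arrows: "units G \<subseteq> arrows G"
  by (auto simp: units_def rng_in)

lemma topspace_unit_top: "topspace (unit_top G) = units G"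
  using units_subset_arrows by (auto simp: unit_top_def)

lemma rng_unit: "u \<in> units G \<Longrightarrow> rng G u = u"
  by (simp add: unit_iff)

lemma src_unit: "u \<in> units G \<Longrightarrow> src G u = u"
  using src_rng unit_iff by metis

lemma inv_unit:
  assumes "u \<in> units G"
  shows "ginv G u = u"
proof -
  have u: "u \<in> arrows G" "rng G u = u" "src G u = u"
    using assms unit_iff src_unit by auto
  then show ?thesis
    using rng_left[of "ginv G u"] mult_inv[of u] by (simp add: inv_in rng_inv)
qed

lemma setpow_subset_arrows:
  assumes "B \<subseteq> arrows G"
  shows "setpow G B n \<subseteq> arrows G"
proof (cases n)
  case 0
  then show ?thesis using units_subset_arrows by simp
next
  case (Suc m)
  then show ?thesis by (auto simp: setmult_def mult_in)
qed

text \<open>Powers start from the unit space, so the first power consists of products u b;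
  composability forces u to be the range of b.\<close>

lemma setpow_one:
  assumes "B \<subseteq> arrows G"
  shows "setpow G B (Suc 0) = B"
proof
  show "setpow G B (Suc 0) \<subseteq> B"
  proof
    fix g assume "g \<in> setpow G B (Suc 0)"
    then obtain u b where "u \<in> units G" "b \<in> B" "(u, b) \<in> composable G" "g = gmult G u b"
      by (auto simp: setmult_def)
    then show "g \<in> B" using assms rng_left[of b] src_unit[of u] by (auto simp: composable_def)
  qed
  show "B \<subseteq> setpow G B (Suc 0)"
  proof
    fix b assume b: "b \<in> B"
    then have "gmult G (rng G b) b \<in> setmult G (units G) B"
      using assms by (intro setmultI) (auto simp: units_def composable_def rng_in src_rng)
    then show "b \<in> setpow G B (Suc 0)" using b assms by (auto simp: rng_left)
  qed
qed

text \<open>The range of a product is that of its first factor in \<open>B\<close>, the leading unit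
  being absorbed. The zeroth power is excluded, since it contains all units, whether or not they are
  ranges of elements of \<open>B\<close>.\<close>

lemma rng_setpow_Suc:
  assumes "g \<in> setpow G B (Suc n)"
  shows "rng G g \<in> rng G ` B"
  using assms
proof (induction n arbitrary: g)
  case 0
  then obtain u b where "u \<in> units G" "b \<in> B" "(u, b) \<in> composable G" "g = gmult G u b"
    by (auto simp: setmult_def)
  then show ?case using src_unit[of u] rng_unit[of u] rng_mult[of u b] by (auto simp: composable_def)
next
  case (Suc n)
  then obtain h b where "h \<in> setpow G B (Suc n)" "(h, b) \<in> composable G" "g = gmult G h b"
    unfolding setpow.simps(2)[of G B "Suc n"] setmult_def by blast
  then show ?case using Suc.IH[of h] rng_mult[of h b] by simp
qed

lemma src_setpow_Suc:
  assumes "g \<in> setpow G B (Suc n)"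
  shows "src G g \<in> src G ` B"
proof -
  obtain h b where "b \<in> B" "(h, b) \<in> composable G" "g = gmult G h b"
    using assms by (auto simp: setmult_def)
  then show ?thesis using src_mult[of h b] by simp
qed

text \<open>Inserts m^-1 m between g and h: this is the unit \<open>src G m\<close>, which equals
  both \<open>src G g\<close> and \<open>rng G h\<close>.\<close>

lemma conjugate_mult:
  assumes "(l, g) \<in> composable G" "(g, h) \<in> composable G" "k \<in> arrows G" "m \<in> arrows G"
    and "src G m = src G g" "src G k = src G h"
  shows "gmult G (gmult G l (gmult G g h)) (ginv G k) =
    gmult G (gmult G (gmult G l g) (ginv G m)) (gmult G (gmult G m h) (ginv G k))"
proof -
  note mult_simps = composable_def mult_in rng_mult src_mult inv_in rng_inv src_inv
  have a: "l \<in> arrows G" "g \<in> arrows G" "h \<in> arrows G" "k \<in> arrows G" "m \<in> arrows G"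
      "src G l = rng G g" "src G g = rng G h" "src G m = rng G h" "src G k = src G h"
    using assms by (auto simp: composable_def)
  have lg: "gmult G l g \<in> arrows G" "src G (gmult G l g) = rng G h"
    and mh: "gmult G m h \<in> arrows G" "src G (gmult G m h) = src G h" "rng G (gmult G m h) = rng G m"
    using a by (auto simp: mult_simps)
  have mhk: "gmult G (gmult G m h) (ginv G k) \<in> arrows G"
      "rng G (gmult G (gmult G m h) (ginv G k)) = rng G m"
    using a mh by (auto simp: mult_simps)
  have hk: "gmult G h (ginv G k) \<in> arrows G" "rng G (gmult G h (ginv G k)) = rng G h"
    using a by (auto simp: mult_simps)
  have cancel: "gmult G (ginv G m) (gmult G (gmult G m h) (ginv G k)) = gmult G h (ginv G k)"
  proof -
    have "gmult G (gmult G m h) (ginv G k) = gmult G m (gmult G h (ginv G k))"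
      using a by (intro mult_assoc) (auto simp: mult_simps)
    moreover have "gmult G (ginv G m) (gmult G m (gmult G h (ginv G k))) =
        gmult G (gmult G (ginv G m) m) (gmult G h (ginv G k))"
      using a hk by (intro mult_assoc[symmetric]) (auto simp: composable_def inv_in src_inv)
    ultimately show ?thesis using a hk rng_left[of "gmult G h (ginv G k)"] by (simp add: inv_mult)
  qed
  have "gmult G (gmult G (gmult G l g) (ginv G m)) (gmult G (gmult G m h) (ginv G k)) =
      gmult G (gmult G l g) (gmult G h (ginv G k))"
    using a lg mhk by (subst mult_assoc) (auto simp: cancel composable_def inv_in src_inv rng_inv)
  also have "\<dots> = gmult G (gmult G (gmult G l g) h) (ginv G k)"
    using a lg by (intro mult_assoc[symmetric]) (auto simp: composable_def inv_in rng_inv)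
  also have "gmult G (gmult G l g) h = gmult G l (gmult G g h)"
    using a by (intro mult_assoc) (auto simp: composable_def)
  finally show ?thesis by simp
qed

end

section \<open>Rewriting products of generators inside the reduction\<close>

text \<open>An element l s k^-1 has range \<open>rng G l\<close> and source \<open>rng G k\<close>,
  and both lie in \<open>U\<close>.\<close>

lemma (in groupoid) setmult_conjugate_subset:
  assumes "L \<subseteq> arrows G" "rng G ` L \<subseteq> U"
  shows "setmult G (setmult G L S) (ginv G ` L) \<subseteq> arrows (reduction G U)"
proof
  fix g assume "g \<in> setmult G (setmult G L S) (ginv G ` L)"
  then obtain l s k where "l \<in> L" "k \<in> L" "(l, s) \<in> composable G"
      "(gmult G l s, ginv G k) \<in> composable G" "g = gmult G (gmult G l s) (ginv G k)"
    by (auto simp: setmult_def)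
  then show "g \<in> arrows (reduction G U)"
    using assms src_inv[OF subsetD[OF assms(1) \<open>k \<in> L\<close>]]
    by (auto simp: arrows_reduction mult_in src_mult rng_mult)
qed

text \<open>Induction on the number of factors, splitting off the last one by
  \<open>conjugate_mult\<close>. The right end \<open>k\<close> is generalised because the shorter
  product is conjugated by the inserted \<open>m\<close> instead. Only positive powers occur: for a
  unit u the element l u k^-1 need not be a unit.\<close>

lemma (in groupoid) setpow_reduction_conjugate:
  assumes U: "U \<subseteq> units G" and S: "S \<subseteq> arrows G"
    and L: "L \<subseteq> arrows G" "rng G ` L \<subseteq> U" "src G ` S \<subseteq> src G ` L"
    and g: "g \<in> setpow G S (Suc n)"
    and l: "l \<in> L" "k \<in> L" "src G l = rng G g" "src G k = src G g"
  shows "gmult G (gmult G l g) (ginv G k) \<in>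
    setpow (reduction G U) (setmult G (setmult G L S) (ginv G ` L)) (Suc n)"
    (is "_ \<in> setpow _ ?M _")
  using g l
proof (induction n arbitrary: g k)
  interpret R: groupoid "reduction G U" using U by (rule groupoid_reduction)
  have M: "gmult G (gmult G m h) (ginv G k) \<in> ?M"
      "gmult G (gmult G m h) (ginv G k) \<in> arrows (reduction G U)"
      "rng G (gmult G (gmult G m h) (ginv G k)) = rng G m"
    if "m \<in> L" "h \<in> S" "k \<in> L" "src G m = rng G h" "src G k = src G h" for m h k
  proof -
    have c: "(m, h) \<in> composable G" using that S L by (auto simp: composable_def)
    then have c': "(gmult G m h, ginv G k) \<in> composable G"
      using that L by (auto simp: composable_def mult_in src_mult[OF c] inv_in rng_inv)
    show "gmult G (gmult G m h) (ginv G k) \<in> ?M"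
      using that c c' by (intro setmultI) auto
    then show "gmult G (gmult G m h) (ginv G k) \<in> arrows (reduction G U)"
      using setmult_conjugate_subset[OF L(1,2)] by blast
    show "rng G (gmult G (gmult G m h) (ginv G k)) = rng G m"
      using c c' by (simp add: rng_mult)
  qed
  {
    case 0
    then have "g \<in> S" using setpow_one[OF S] by simp
    moreover have "setpow (reduction G U) ?M (Suc 0) = ?M"
      using R.setpow_one setmult_conjugate_subset[OF L(1,2)] by blast
    ultimately show ?case using M 0 by (simp del: setpow.simps)
  next
    case (Suc n)
    obtain h b where hb: "h \<in> setpow G S (Suc n)" "b \<in> S" "(h, b) \<in> composable G" "g = gmult G h b"
      using Suc.prems(1) unfolding setpow.simps(2)[of G S "Suc n"] setmult_def by blast
    have rs: "rng G g = rng G h" "src G g = src G b" "src G h = rng G b" "h \<in> arrows G" "b \<in> arrows G"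
      using hb rng_mult src_mult by (auto simp: composable_def)
    \<comment> \<open>The source of \<open>h\<close> is the source of its last factor in
      \<open>S\<close>, hence the source of some element of \<open>L\<close>.\<close>
    obtain m where m: "m \<in> L" "src G m = src G h"
      using src_setpow_Suc[OF hb(1)] L(3) by (metis image_iff subsetD)
    have lm: "gmult G (gmult G l h) (ginv G m) \<in> setpow (reduction G U) ?M (Suc n)"
      using Suc.prems m rs by (intro Suc.IH hb(1)) auto
    have mrb: "src G m = rng G b" and kb: "src G k = src G b"
      using m rs Suc.prems by auto
    note mb = M[OF m(1) hb(2) \<open>k \<in> L\<close> mrb kb]
    have eq: "gmult G (gmult G l g) (ginv G k) =
        gmult G (gmult G (gmult G l h) (ginv G m)) (gmult G (gmult G m b) (ginv G k))"
      unfolding hb(4) using hb m Suc.prems L(1) rs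
      by (intro conjugate_mult) (auto simp: composable_def)
    have c1: "(l, h) \<in> composable G" using Suc.prems rs L by (auto simp: composable_def)
    then have c2: "(gmult G l h, ginv G m) \<in> composable G"
      using m L by (auto simp: composable_def mult_in src_mult[OF c1] inv_in rng_inv)
    have "(gmult G (gmult G l h) (ginv G m), gmult G (gmult G m b) (ginv G k))
        \<in> composable (reduction G U)"
    proof -
      have "m \<in> arrows G" using m L by blast
      then have s: "src G (gmult G (gmult G l h) (ginv G m)) = rng G m"
        using c2 by (simp add: src_mult src_inv)
      have r: "rng G (gmult G (gmult G l h) (ginv G m)) = rng G l"
        using c1 c2 by (simp add: rng_mult)
      show ?thesis
        using s r mb Suc.prems(2) mult_in[OF c2] L
        by (auto simp: composable_def arrows_reduction)
    qed
    then have "gmult (reduction G U) (gmult G (gmult G l h) (ginv G m))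
          (gmult G (gmult G m b) (ginv G k)) \<in>
        setmult (reduction G U) (setpow (reduction G U) ?M (Suc n)) ?M"
      by (rule setmultI[OF lm mb(1)])
    then show ?case unfolding eq by simp
  }
qed

section \<open>Compactness of products in an ample groupoid\<close>

lemma (in ample_groupoid) neighbourhood_base_units:
  "neighbourhood_base_of (compactin (unit_top G)) (unit_top G)"
  using Hausdorff_units locally_compact_units locally_compact_space_neighbourhood_base by blast

lemma (in ample_groupoid) continuous_rng: "continuous_map (arr_top G) (unit_top G) (rng G)"
  and continuous_src: "continuous_map (arr_top G) (unit_top G) (src G)"
  using local_homeomorphism_rng local_homeomorphism_src
  by (auto intro: local_homeomorphism_imp_continuous_map)

text \<open>The composable pairs form the equalizer of two continuous maps into the Hausdorff unit
  space; the arrow space itself may fail to be Hausdorff.\<close>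

lemma (in ample_groupoid) closedin_composable:
  "closedin (prod_topology (arr_top G) (arr_top G)) (composable G)"
proof -
  have "closedin (prod_topology (arr_top G) (arr_top G))
      {x \<in> topspace (prod_topology (arr_top G) (arr_top G)). (src G \<circ> fst) x = (rng G \<circ> snd) x}"
    using continuous_map_compose[OF continuous_map_fst continuous_src]
      continuous_map_compose[OF continuous_map_snd continuous_rng]
    by (intro closedin_continuous_maps_eq[OF Hausdorff_units])
  also have "{x \<in> topspace (prod_topology (arr_top G) (arr_top G)).
      (src G \<circ> fst) x = (rng G \<circ> snd) x} = composable G"
    by (auto simp: composable_def)
  finally show ?thesis .
qed

text \<open>The product is the continuous image of the composable pairs in
  \<open>B \<times> C\<close>, a closed part of a compact set.\<close>

lemma (in ample_groupoid) compactin_setmult: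
  assumes "compactin (arr_top G) B" "compactin (arr_top G) C"
  shows "compactin (arr_top G) (setmult G B C)"
proof -
  have "compactin (prod_topology (arr_top G) (arr_top G)) (composable G \<inter> B \<times> C)"
    using assms by (intro closed_Int_compactin closedin_composable) (simp add: compactin_Times)
  then have "compactin (subtopology (prod_topology (arr_top G) (arr_top G)) (composable G))
      (composable G \<inter> B \<times> C)"
    by (simp add: compactin_subtopology)
  from image_compactin[OF this continuous_mult] show ?thesis
    by (rule back_subst[of "compactin (arr_top G)"]) (auto simp: setmult_def)
qed

section \<open>The compact generating set of the reduction\<close>

theorem theorem5p5:
  fixes G :: "'a groupoid_data" and U :: "'a set"
  assumes "ample_groupoid G"
    and "compactly_generated G"
    and "openin (unit_top G) U" and "closedin (unit_top G) U"
    and "full G U"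
  shows "compactly_generated (reduction G U)"
proof -
  interpret ample_groupoid G by fact
  have U: "U \<subseteq> units G" using assms(3) openin_subset topspace_unit_top by blast
  interpret R: groupoid "reduction G U" using U by (rule groupoid_reduction)
  obtain K where K: "compactin (arr_top G) K" "arrows G = (\<Union>n. setpow G (K \<union> ginv G ` K) n)"
    using assms(2) unfolding compactly_generated_def by blast
  define S where "S = K \<union> ginv G ` K"
  have S: "compactin (arr_top G) S"
    unfolding S_def using K(1) image_compactin[OF K(1) continuous_inv] by (rule compactin_Un)
  have Sa: "S \<subseteq> arrows G" using S compactin_subset_topspace by blast
  define C where "C = src G ` S"
  \<comment> \<open>\<open>S\<close> is closed under inversion, so each range of an element of
    \<open>S\<close> is also a source of one.\<close>
  have Crng: "rng G ` S \<subseteq> C"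
  proof (rule image_subsetI)
    fix s assume s: "s \<in> S"
    have "K \<subseteq> arrows G" using Sa S_def by blast
    then have "ginv G s \<in> S" using s inv_inv by (auto simp: S_def)
    then show "rng G s \<in> C" using s Sa src_inv[of s] unfolding C_def by (metis image_eqI subsetD)
  qed
  have C: "compactin (unit_top G) C"
    unfolding C_def using S continuous_src by (rule image_compactin)
  have Cu: "C \<subseteq> units G" using C compactin_subset_topspace topspace_unit_top by blast
  define N where "N = {g \<in> arrows G. rng G g \<in> U}"
  have N: "openin (arr_top G) N"
    unfolding N_def using continuous_rng assms(3) by (rule openin_continuous_map_preimage)
  \<comment> \<open>By fullness each u in \<open>C\<close> is the source of an arrow with range in
    \<open>U\<close>, that is, of an element of \<open>N\<close>.\<close>
  have "C \<subseteq> src G ` N"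
  proof
    fix u assume "u \<in> C"
    then have "orbit G u \<inter> U \<noteq> {}" using Cu assms(5) by (auto simp: full_def)
    then show "u \<in> src G ` N" by (auto simp: orbit_def N_def)
  qed
  then obtain L0 where L0: "compactin (arr_top G) L0" "L0 \<subseteq> N" "C \<subseteq> src G ` L0"
    using local_homeomorphism_lift_compact[OF local_homeomorphism_src neighbourhood_base_units N C]
    by blast
  \<comment> \<open>The added units are the possible ends of a nonempty product of generators that
    lies in the reduction; conjugating by them leaves the product unchanged.\<close>
  define L where "L = L0 \<union> (U \<inter> C)"
  have "compactin (unit_top G) (U \<inter> C)" using assms(4) C by (rule closed_Int_compactin)
  then have L: "compactin (arr_top G) L"
    unfolding L_def using L0(1) by (intro compactin_Un) (auto simp: unit_top_def compactin_subtopology)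
  have La: "L \<subseteq> arrows G" using L compactin_subset_topspace by blast
  have rL: "rng G ` L \<subseteq> U"
    using L0(2) U rng_unit by (auto simp: L_def N_def)
  define M where "M = setmult G (setmult G L S) (ginv G ` L)"
  have "compactin (arr_top G) M"
    unfolding M_def using L S image_compactin[OF L continuous_inv]
    by (intro compactin_setmult)
  moreover have MR: "M \<subseteq> arrows (reduction G U)"
    unfolding M_def using La rL by (rule setmult_conjugate_subset)
  ultimately have M: "compactin (arr_top (reduction G U)) M"
    unfolding arrows_reduction by (simp add: reduction_def compactin_subtopology)
  \<comment> \<open>Compact generation is phrased with the symmetrised set;
    \<open>setpow_mono\<close> passes from powers of \<open>M\<close> to powers of
    \<open>T\<close>.\<close>
  define T where "T = M \<union> ginv G ` M"
  have Ta: "T \<subseteq> arrows (reduction G U)"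
    using MR R.inv_in unfolding T_def by auto
  have "arrows (reduction G U) = (\<Union>n. setpow (reduction G U) T n)"
  proof
    show "(\<Union>n. setpow (reduction G U) T n) \<subseteq> arrows (reduction G U)"
      using R.setpow_subset_arrows[OF Ta] by blast
    show "arrows (reduction G U) \<subseteq> (\<Union>n. setpow (reduction G U) T n)"
    proof
      fix g assume "g \<in> arrows (reduction G U)"
      then have g: "g \<in> arrows G" "src G g \<in> U" "rng G g \<in> U" by (auto simp: arrows_reduction)
      then obtain n where n: "g \<in> setpow G S n" using K(2) S_def by blast
      show "g \<in> (\<Union>n. setpow (reduction G U) T n)"
      proof (cases n)
        \<comment> \<open>Here g is a unit, so g equals its range, which lies in \<open>U\<close>,
          the unit space of the reduction.\<close>
        case 0
        then have "g \<in> setpow (reduction G U) T 0"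
          using n g rng_unit units_reduction[OF U] by auto
        then show ?thesis by blast
      next
        case (Suc m)
        then have gm: "g \<in> setpow G S (Suc m)" using n by simp
        have ends: "rng G g \<in> L" "src G g \<in> L"
          using rng_setpow_Suc[OF gm] src_setpow_Suc[OF gm] Crng g by (auto simp: L_def C_def)
        have sL: "src G ` S \<subseteq> src G ` L" using L0(3) by (auto simp: C_def L_def)
        \<comment> \<open>The outer conjugators are the units at the two ends of \<open>g\<close>,
          so the conjugate is \<open>g\<close> itself.\<close>
        have "gmult G (gmult G (rng G g) g) (ginv G (src G g)) \<in> setpow (reduction G U) M (Suc m)"
          unfolding M_def using g(1) by (intro setpow_reduction_conjugate U Sa La rL sL gm ends)
            (simp_all add: src_rng src_src)
        moreover have "ginv G (src G g) = src G g" using g U inv_unit by blast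
        ultimately have "g \<in> setpow (reduction G U) M (Suc m)"
          using g(1) by (simp add: rng_left src_right del: setpow.simps)
        then show ?thesis using setpow_mono[of M T] unfolding T_def by blast
      qed
    qed
  qed
  then show ?thesis
    using M unfolding compactly_generated_def T_def by auto
qed

end
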